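(* Let $X$ and $Y$ be non-degenerate compact metrizable spaces, and let $T : \operatorname{SPM}(X) \to \operatorname{SPM}(Y)$ be a surjective isometry. Then there exists a homeomorphism $\phi : Y \to X$ such that for any $d \in \operatorname{SPM}(X)$ and for any $x, y \in Y$, $$T(d)(x,y) = d(\phi(x),\phi(y)).$$ Moreover, except for the case where the cardinality of $X$ or $Y$ is equal to $2$, the homeomorphism $\phi : Y \to X$ with this property is unique.
   Context: A space is non-degenerate if it contains at least two points. For a topological space $Z$, $\operatorname{C}(Z^2)$ denotes the Banach space of bounded continuous real-valued functions on $Z^2 = Z \times Z$ with the sup-norm $\|\cdot\|$. $\operatorname{PM}(Z) \subset \operatorname{C}(Z^2)$ is the subspace of bounded continuous pseudometrics on $Z$, and $\operatorname{SPM}(Z) = \{d \in \operatorname{PM}(Z) \mid \|d\| = 1\}$ is its unit sphere. Both carry the sup-metric $(d,\rho) \mapsto \|d - \rho\|$, and isometries are with respect to these metrics. *)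

theory Defs
  imports "HOL-Analysis.Analysis"
begin

definition PM :: "(('a::topological_space \<times> 'a) \<Rightarrow>\<^sub>C real) set" where
  "PM = {d. (\<forall>x y. 0 \<le> apply_bcontfun d (x, y)) \<and>
            (\<forall>x. apply_bcontfun d (x, x) = 0) \<and>
            (\<forall>x y. apply_bcontfun d (x, y) = apply_bcontfun d (y, x)) \<and>
            (\<forall>x y z. apply_bcontfun d (x, z) \<le> apply_bcontfun d (x, y) + apply_bcontfun d (y, z))}"

definition SPM :: "(('a::topological_space \<times> 'a) \<Rightarrow>\<^sub>C real) set" where
  "SPM = {d \<in> PM. norm d = 1}"

definition surjective_isometry_on ::
    "('a::metric_space \<Rightarrow> 'b::metric_space) \<Rightarrow> 'a set \<Rightarrow> 'b set \<Rightarrow> bool" where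
  "surjective_isometry_on T A B \<longleftrightarrow>
     T ` A = B \<and> (\<forall>d\<in>A. \<forall>\<rho>\<in>A. dist (T d) (T \<rho>) = dist d \<rho>)"

end

theory Submission
  imports Defs
begin

text \<open>By compactness, two elements of \<open>SPM\<close> have distance 1, the largest possible, iff one
  of them equals 1 at a pair where the other vanishes. If \<open>d\<close> is a metric attaining 1 only at
  \<open>{a, b}\<close>, the elements at distance 1 from \<open>d\<close> are thus exactly those vanishing at \<open>(a, b)\<close>;
  such sets are the minimal ones among all sets \<open>{\<rho>. dist d \<rho> = 1}\<close>. A surjective isometry
  permutes them and so induces a bijection between the two-point subsets of \<open>X\<close> and of \<open>Y\<close>.
  As vanishing at two sides of a triangle forces vanishing at the third one, and no other
  implication of this kind holds, triangles go to triangles, so this bijection comes from a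
  bijection of the points. Finally \<open>d (a, b)\<close> is the distance from \<open>d\<close> to the set of
  elements of \<open>SPM\<close> vanishing at \<open>(a, b)\<close>, which the isometry preserves.\<close>

section \<open>Bounded continuous functions and elements of \<open>SPM\<close>\<close>

lemma bcontfun_norm_attained:
  fixes f :: "'a::topological_space \<Rightarrow>\<^sub>C 'b::real_normed_vector"
  assumes "compact (UNIV :: 'a set)"
  obtains p where "norm (f p) = norm f"
proof -
  have "continuous_on UNIV (\<lambda>p. norm (f p))"
    by (intro continuous_intros; simp)
  then obtain p where p: "\<And>q. norm (f q) \<le> norm (f p)"
    using continuous_attains_sup[OF assms, of "\<lambda>p. norm (f p)"] by auto
  have "norm f = norm (f p)"
    by (intro antisym norm_bound p norm_bounded)
  then show ?thesis using that by auto
qed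

lemma SPM_dest:
  assumes "d \<in> SPM"
  shows "0 \<le> d (x, y)" "d (x, x) = 0" "d (x, y) = d (y, x)"
    "d (x, z) \<le> d (x, y) + d (y, z)" "d (x, y) \<le> 1"
proof -
  have "norm (d (x, y)) \<le> norm d" by (rule norm_bounded)
  then show "d (x, y) \<le> 1" using assms by (auto simp: SPM_def)
qed (use assms in \<open>force simp: SPM_def PM_def\<close>)+

text \<open>Values at most 1 together with one pair of value 1 make the sup-norm exactly 1, so a
  pseudometric only has to exhibit its peak \<open>(a, b)\<close>.\<close>

lemma SPM_intro:
  fixes r :: "'a::topological_space \<Rightarrow> 'a \<Rightarrow> real"
  assumes cont: "continuous_on UNIV (\<lambda>p. r (fst p) (snd p))"
    and r: "\<And>x y. 0 \<le> r x y" "\<And>x. r x x = 0" "\<And>x y. r x y = r y x"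
      "\<And>x y z. r x z \<le> r x y + r y z" "\<And>x y. r x y \<le> 1"
    and peak: "r a b = 1"
  obtains d where "d \<in> SPM" "\<And>x y. apply_bcontfun d (x, y) = r x y"
proof -
  define d where "d = Bcontfun (\<lambda>p. r (fst p) (snd p))"
  have "(\<lambda>p. r (fst p) (snd p)) \<in> bcontfun"
    by (rule bcontfun_normI[where b = 1]; use cont r in simp)
  then have d: "d (x, y) = r x y" for x y
    by (simp add: d_def Bcontfun_inverse)
  have "norm (d (a, b)) \<le> norm d" by (rule norm_bounded)
  moreover have "norm d \<le> 1"
    by (rule norm_bound) (use r d in auto)
  ultimately have "norm d = 1" using peak d by simp
  then have "d \<in> SPM"
    unfolding SPM_def PM_def mem_Collect_eq d by (intro conjI allI r)
  then show ?thesis using that d by blast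
qed

text \<open>The isometry acts on these sets for two-point \<open>A\<close>; arbitrary
  \<open>A\<close> is allowed because separation arguments collapse larger finite sets to a
  point.\<close>

definition vanishing :: "'a set \<Rightarrow> (('a::topological_space \<times> 'a) \<Rightarrow>\<^sub>C real) set" where
  "vanishing A = {\<rho> \<in> SPM. \<forall>x\<in>A. \<forall>y\<in>A. \<rho> (x, y) = 0}"

definition antipodal :: "(('a::topological_space \<times> 'a) \<Rightarrow>\<^sub>C real) \<Rightarrow> (('a \<times> 'a) \<Rightarrow>\<^sub>C real) set" where
  "antipodal d = {\<rho> \<in> SPM. dist d \<rho> = 1}"

lemma vanishing_doubleton:
  "\<rho> \<in> vanishing {a, b} \<longleftrightarrow> \<rho> \<in> SPM \<and> \<rho> (a, b) = 0"
  using SPM_dest(2)[of \<rho>] SPM_dest(3)[of \<rho> a b] by (auto simp: vanishing_def)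

lemma vanishing_subset_SPM: "vanishing A \<subseteq> SPM"
  by (auto simp: vanishing_def)

lemma vanishing_Int_subset_triangle:
  "vanishing {x, y} \<inter> vanishing {x, z} \<subseteq> vanishing {y, z}"
proof
  fix \<rho> assume "\<rho> \<in> vanishing {x, y} \<inter> vanishing {x, z}"
  then have \<rho>: "\<rho> \<in> SPM" "\<rho> (x, y) = 0" "\<rho> (x, z) = 0"
    by (auto simp: vanishing_doubleton)
  then have "\<rho> (y, z) = 0"
    using SPM_dest(1)[OF \<rho>(1), of y z] SPM_dest(4)[OF \<rho>(1), of y z x]
      SPM_dest(3)[OF \<rho>(1), of y x] by simp
  then show "\<rho> \<in> vanishing {y, z}" using \<rho> by (simp add: vanishing_doubleton)
qed

text \<open>\<open>Q\<close> is \<open>D\<close> after identifying \<open>a\<close> with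
  \<open>b\<close>: a path goes directly or jumps once between the two points, and a second jump
  never helps. Each of the nine choices for the two minima on the right is a linear
  inequality.\<close>

lemma quotient_pseudometric_triangle:
  fixes D :: "'a \<Rightarrow> 'a \<Rightarrow> real" and a b :: 'a
  assumes "\<And>x y. 0 \<le> D x y" "\<And>x y. D x y = D y x" "\<And>x y z. D x z \<le> D x y + D y z"
  defines "Q \<equiv> \<lambda>x y. min (D x y) (min (D x a + D b y) (D x b + D a y))"
  shows "Q x z \<le> Q x y + Q y z"
proof -
  have "Q x z \<le> D x z" "Q x z \<le> D x a + D b z" "Q x z \<le> D x b + D a z"
    by (simp add: Q_def)+
  moreover have "D x z \<le> D x y + D y z" "D x z \<le> D x a + D a z" "D x z \<le> D x b + D b z"
    "D b z \<le> D b y + D y z" "D a z \<le> D a y + D y z"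
    "D x a \<le> D x y + D y a" "D x b \<le> D x y + D y b"
    "0 \<le> D a y" "0 \<le> D b y" "D y a = D a y" "D y b = D b y"
    using assms(1-3) by blast+
  ultimately have "Q x z \<le> u + v"
    if "u \<in> {D x y, D x a + D b y, D x b + D a y}" "v \<in> {D y z, D y a + D b z, D y b + D a z}" for u v
    using that by (elim insertE emptyE; linarith)
  moreover have "Q x y \<in> {D x y, D x a + D b y, D x b + D a y}"
    "Q y z \<in> {D y z, D y a + D b z, D y b + D a z}"
    by (simp add: Q_def min_def)+
  ultimately show ?thesis by blast
qed

section \<open>Compact spaces with a bounded metric\<close>

text \<open>The types carry only a topology, so the metric is a parameter; \<open>cont\<close> and
  \<open>ball\<close> together say that it induces this topology. By \<open>le_1\<close>, the
  function \<open>m x y / 2\<close> stays below 1 and never creates a peak.\<close>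

locale compact_metric =
  fixes m :: "'a::topological_space \<Rightarrow> 'a \<Rightarrow> real"
  assumes compact: "compact (UNIV :: 'a set)"
    and nonneg: "0 \<le> m x y" and eq_0_iff: "m x y = 0 \<longleftrightarrow> x = y"
    and sym: "m x y = m y x" and triangle: "m x z \<le> m x y + m y z"
    and le_1: "m x y \<le> 1"
    and cont: "continuous_on UNIV (\<lambda>p. m (fst p) (snd p))"
    and ball: "\<lbrakk>open U; x \<in> U\<rbrakk> \<Longrightarrow> \<exists>\<epsilon>>0. \<forall>y. m x y < \<epsilon> \<longrightarrow> y \<in> U"

lemma compact_metric_exists:
  assumes "compact_space (euclidean :: 'a::topological_space topology)"
    and "metrizable_space (euclidean :: 'a::topological_space topology)"
  obtains m :: "'a::topological_space \<Rightarrow> 'a \<Rightarrow> real" where "compact_metric m"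
proof -
  obtain M d where "Metric_space M d" and eu: "(euclidean :: 'a topology) = Metric_space.mtopology M d"
    using assms(2) by (auto simp: metrizable_space_def)
  interpret Metric_space M d by fact
  have "M = UNIV" using arg_cong[OF eu, of topspace] by simp
  note M = this
  have dcont: "continuous_on UNIV (\<lambda>p. d (fst p) (snd p))"
  proof -
    have "continuous_map euclidean (mtopology_of (metric (M, d))) (fst :: 'a \<times> 'a \<Rightarrow> 'a)"
      "continuous_map euclidean (mtopology_of (metric (M, d))) (snd :: 'a \<times> 'a \<Rightarrow> 'a)"
      by (simp add: mtopology_of continuous_on_fst continuous_on_snd flip: eu)+
    from continuous_map_mdist[OF this] show ?thesis
      by simp
  qed
  \<comment> \<open>Truncation at 1 supplies the bound and leaves small balls unchanged.\<close>
  have "compact_metric (\<lambda>x y. min 1 (d x y))"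
  proof
    show "compact (UNIV :: 'a set)" using assms(1) by (simp add: compact_space_def)
    show "continuous_on UNIV (\<lambda>p. min 1 (d (fst p) (snd p)))"
      by (intro continuous_intros dcont)
    show "min 1 (d x z) \<le> min 1 (d x y) + min 1 (d y z)" for x y z
      using triangle[of x y z] M nonneg[of x y] nonneg[of y z] by (simp add: min_def; linarith)
    show "min 1 (d x y) = min 1 (d y x)" for x y by (simp add: commute)
    show "min 1 (d x y) = 0 \<longleftrightarrow> x = y" for x y using M by (auto simp: min_def)
    fix U :: "'a set" and x assume "open U" "x \<in> U"
    then have "openin mtopology U" by (simp flip: eu)
    then obtain r where r: "r > 0" "mball x r \<subseteq> U" using \<open>x \<in> U\<close>
      by (auto simp: openin_mtopology)
    have "y \<in> U" if "d x y < r" for y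
      using r(2) that by (intro subsetD[OF r(2)]) (simp only: in_mball, simp add: M)
    then show "\<exists>\<epsilon>>0. \<forall>y. min 1 (d x y) < \<epsilon> \<longrightarrow> y \<in> U"
      using \<open>r > 0\<close> by (intro exI[of _ "min 1 r"] conjI; force)
  qed simp+
  then show ?thesis using that by blast
qed

context compact_metric
begin

lemma cont_comp:
  assumes "continuous_on UNIV f" "continuous_on UNIV g"
  shows "continuous_on UNIV (\<lambda>x. m (f x) (g x))"
  using continuous_on_compose2[OF cont continuous_on_Pair[OF assms]] by simp

lemma compact_prod: "compact (UNIV :: ('a \<times> 'a) set)"
  using compact_Times[OF compact compact] by simp

lemma SPM_peak:
  fixes d :: "('a \<times> 'a) \<Rightarrow>\<^sub>C real"
  assumes "d \<in> SPM"
  obtains a b where "d (a, b) = 1" "a \<noteq> b"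
proof -
  obtain p where "norm (d p) = norm d"
    using bcontfun_norm_attained[OF compact_prod] .
  moreover obtain a b where "p = (a, b)" by fastforce
  ultimately have "d (a, b) = 1"
    using assms SPM_dest(1)[OF assms, of a b] by (auto simp: SPM_def)
  then show ?thesis using that SPM_dest(2)[OF assms] by fastforce
qed

text \<open>All values lie in the unit interval, so a difference of absolute value 1 forces the
  values 0 and 1; compactness makes the supremum a value.\<close>

lemma dist_eq_1_iff:
  fixes d \<rho> :: "('a \<times> 'a) \<Rightarrow>\<^sub>C real"
  assumes "d \<in> SPM" "\<rho> \<in> SPM"
  shows "dist d \<rho> = 1 \<longleftrightarrow>
    (\<exists>x y. d (x, y) = 1 \<and> \<rho> (x, y) = 0 \<or> d (x, y) = 0 \<and> \<rho> (x, y) = 1)"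
    (is "_ \<longleftrightarrow> ?R")
proof
  assume 1: "dist d \<rho> = 1"
  obtain p where p: "norm ((d - \<rho>) p) = norm (d - \<rho>)"
    using bcontfun_norm_attained[OF compact_prod] .
  obtain x y where xy: "p = (x, y)" by fastforce
  have "\<bar>d (x, y) - \<rho> (x, y)\<bar> = 1" using 1 p xy by (simp add: dist_norm)
  then show ?R
    using SPM_dest(1,5)[OF assms(1), of x y] SPM_dest(1,5)[OF assms(2), of x y]
    by (intro exI[of _ x] exI[of _ y]) (auto simp: abs_if split: if_splits)
next
  assume ?R
  then obtain x y where "d (x, y) = 1 \<and> \<rho> (x, y) = 0 \<or> d (x, y) = 0 \<and> \<rho> (x, y) = 1"
    by blast
  then have "\<bar>d (x, y) - \<rho> (x, y)\<bar> = 1" by auto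
  then have "1 \<le> dist d \<rho>" using dist_bounded[of d "(x, y)" \<rho>] by (simp add: dist_real_def)
  moreover have "dist d \<rho> \<le> 1"
  proof (rule dist_bound)
    fix p show "dist (d p) (\<rho> p) \<le> 1"
      using SPM_dest(1,5)[OF assms(1), of "fst p" "snd p"] SPM_dest(1,5)[OF assms(2), of "fst p" "snd p"]
      by (auto simp: dist_real_def)
  qed
  ultimately show "dist d \<rho> = 1" by simp
qed

section \<open>Construction of pseudometrics\<close>

text \<open>For finite \<open>S\<close> the product \<open>g S\<close> of the distances to its
  points vanishes exactly on \<open>S\<close>, so \<open>g P / (g P + g Q)\<close> has both level
  sets exactly right. This exactness is what later yields a single peak.\<close>

lemma urysohn_finite:
  fixes P Q :: "'a set"
  assumes "finite P" "finite Q" "P \<inter> Q = {}"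
  obtains f :: "'a \<Rightarrow> real" where "continuous_on UNIV f" "\<And>x. 0 \<le> f x" "\<And>x. f x \<le> 1"
    "\<And>x. f x = 0 \<longleftrightarrow> x \<in> P" "\<And>x. f x = 1 \<longleftrightarrow> x \<in> Q"
proof -
  define g where "g S x = (\<Prod>p\<in>S. m x p)" for S x
  have g0: "g S x = 0 \<longleftrightarrow> x \<in> S" if "finite S" for S x
    using that by (auto simp: g_def eq_0_iff)
  have gpos: "0 \<le> g S x" for S x
    unfolding g_def by (intro prod_nonneg) (simp add: nonneg)
  have gcont: "continuous_on UNIV (g S)" for S
    unfolding g_def by (intro continuous_intros cont_comp)
  have ne: "g P x + g Q x \<noteq> 0" for x
    using g0 gpos[of P x] gpos[of Q x] assms
    by (auto simp: add_nonneg_eq_0_iff)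
  have pos: "g P x + g Q x > 0" for x
    using ne[of x] gpos[of P x] gpos[of Q x] by linarith
  show ?thesis
  proof
    show "continuous_on UNIV (\<lambda>x. g P x / (g P x + g Q x))"
      by (intro continuous_intros gcont; use ne in simp)
    show "0 \<le> g P x / (g P x + g Q x)" "g P x / (g P x + g Q x) \<le> 1" for x
      using gpos[of P x] gpos[of Q x] pos[of x] by (simp add: divide_simps)+
    show "g P x / (g P x + g Q x) = 0 \<longleftrightarrow> x \<in> P" for x
      using ne[of x] g0 assms by auto
    show "g P x / (g P x + g Q x) = 1 \<longleftrightarrow> x \<in> Q" for x
      using ne[of x] g0[of Q x] assms by (auto simp: divide_simps)
  qed
qed

text \<open>Pulling back the distance of the real line along a Urysohn function collapses
  \<open>P\<close> to 0 and \<open>Q\<close> to 1.\<close>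

lemma separating_pseudometric:
  fixes P Q :: "'a set"
  assumes "finite P" "finite Q" "P \<inter> Q = {}" and ab: "a \<in> P" "b \<in> Q"
  shows "\<exists>\<sigma>. \<sigma> \<in> vanishing P \<and> \<sigma> \<in> vanishing Q \<and> \<sigma> (a, b) = 1"
proof -
  obtain f :: "'a \<Rightarrow> real" where f: "continuous_on UNIV f" "\<And>x. 0 \<le> f x" "\<And>x. f x \<le> 1"
    "\<And>x. f x = 0 \<longleftrightarrow> x \<in> P" "\<And>x. f x = 1 \<longleftrightarrow> x \<in> Q"
    using urysohn_finite[OF assms(1-3)] by blast
  obtain \<sigma> where "\<sigma> \<in> SPM" and \<sigma>: "\<And>x y. apply_bcontfun \<sigma> (x, y) = \<bar>f x - f y\<bar>"
  proof (rule SPM_intro[of "\<lambda>x y. \<bar>f x - f y\<bar>" a b])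
    show "continuous_on UNIV (\<lambda>p. \<bar>f (fst p) - f (snd p)\<bar>)"
      by (intro continuous_intros continuous_on_compose2[OF f(1)]; simp)
    show "\<bar>f x - f y\<bar> \<le> 1" for x y using f(2,3)[of x] f(2,3)[of y] by (auto simp: abs_if)
    show "\<bar>f a - f b\<bar> = 1" using ab f(4)[of a] f(5)[of b] by simp
  qed simp+
  moreover have "f x = 0" if "x \<in> P" for x using that f(4) by blast
  moreover have "f x = 1" if "x \<in> Q" for x using that f(5) by blast
  ultimately show ?thesis using ab by (auto simp: vanishing_def)
qed

text \<open>In the maximum of \<bar>f x - f y\<bar> and \<open>m x y / 2\<close>, the first term
  reaches 1 only at \<open>{a, b}\<close>, and the second, at most 1/2, makes the result a metric.
  The lower bound also serves to compare topologies.\<close>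

lemma peaked_metric:
  assumes "a \<noteq> b"
  obtains d where "d \<in> SPM" "\<And>x y. m x y / 2 \<le> apply_bcontfun d (x, y)"
    "\<And>x y. apply_bcontfun d (x, y) = 1 \<longleftrightarrow> {x, y} = {a, b}"
proof -
  obtain f :: "'a \<Rightarrow> real" where f: "continuous_on UNIV f" "\<And>x. 0 \<le> f x" "\<And>x. f x \<le> 1"
    "\<And>x. f x = 0 \<longleftrightarrow> x \<in> {a}" "\<And>x. f x = 1 \<longleftrightarrow> x \<in> {b}"
    using urysohn_finite[of "{a}" "{b}"] assms by auto
  define r where "r x y = max \<bar>f x - f y\<bar> (m x y / 2)" for x y
  have r_ge: "\<bar>f x - f y\<bar> \<le> r x y" "m x y / 2 \<le> r x y" for x y
    by (simp add: r_def)+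
  have peak: "r x y = 1 \<longleftrightarrow> {x, y} = {a, b}" for x y
  proof -
    have "r x y = 1 \<longleftrightarrow> \<bar>f x - f y\<bar> = 1"
      using le_1[of x y] by (auto simp: r_def max_def)
    also have "\<dots> \<longleftrightarrow> (f x = 0 \<and> f y = 1 \<or> f x = 1 \<and> f y = 0)"
      using f(2,3)[of x] f(2,3)[of y] by (auto simp: abs_if)
    also have "\<dots> \<longleftrightarrow> {x, y} = {a, b}"
      using f(4,5) by (auto simp: doubleton_eq_iff)
    finally show ?thesis .
  qed
  obtain d where "d \<in> SPM" and d: "\<And>x y. apply_bcontfun d (x, y) = r x y"
  proof (rule SPM_intro[of r a b])
    show "continuous_on UNIV (\<lambda>p. r (fst p) (snd p))" unfolding r_def
      by (intro continuous_intros continuous_on_compose2[OF f(1)] cont; simp)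
    show "r x y \<le> 1" for x y
      using f(2,3)[of x] f(2,3)[of y] le_1[of x y] by (auto simp: r_def abs_if)
    show "r a b = 1" using peak by simp
    show "r x z \<le> r x y + r y z" for x y z
      unfolding r_def[of x z]
      using r_ge[of x y] r_ge[of y z] triangle[of x z y] by (intro max.boundedI) linarith+
    show "r x x = 0" for x using eq_0_iff[of x x] by (simp add: r_def)
    show "r x y = r y x" for x y using sym[of x y] by (auto simp: r_def)
  qed (simp add: r_def)+
  moreover have "m x y / 2 \<le> r x y" for x y by (simp add: r_def)
  ultimately show ?thesis using that[of d] peak by simp
qed

section \<open>Vanishing sets as minimal antipodal sets\<close>

text \<open>A metric with sole peak \<open>{a, b}\<close> is zero only on the diagonal, where every
  \<rho> is zero too. So distance 1 can only come from \<rho> vanishing at the peak.\<close>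

lemma vanishing_is_antipodal:
  fixes a b :: 'a
  assumes "a \<noteq> b"
  obtains d where "d \<in> SPM" "antipodal d = vanishing {a, b}"
proof -
  obtain d where d: "d \<in> SPM" "\<And>x y. m x y / 2 \<le> apply_bcontfun d (x, y)"
    "\<And>x y. apply_bcontfun d (x, y) = 1 \<longleftrightarrow> {x, y} = {a, b}"
    by (rule peaked_metric[OF assms]) (rule that)
  have "dist d \<rho> = 1 \<longleftrightarrow> \<rho> (a, b) = 0" if "\<rho> \<in> SPM" for \<rho>
  proof -
    have "\<rho> (x, y) = 0" if "d (x, y) = 0" for x y
      using that d(2)[of x y] nonneg[of x y] eq_0_iff[of x y] SPM_dest(2)[OF \<open>\<rho> \<in> SPM\<close>] by simp
    then have "\<not> (d (x, y) = 0 \<and> \<rho> (x, y) = 1)" for x y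
      by auto
    then have "dist d \<rho> = 1 \<longleftrightarrow> (\<exists>x y. {x, y} = {a, b} \<and> \<rho> (x, y) = 0)"
      by (simp only: dist_eq_1_iff[OF d(1) that] d(3) simp_thms)
    also have "\<dots> \<longleftrightarrow> \<rho> (a, b) = 0"
      using SPM_dest(3)[OF that] by (auto simp: doubleton_eq_iff)
    finally show ?thesis .
  qed
  then have "antipodal d = vanishing {a, b}"
    by (auto simp: antipodal_def vanishing_doubleton)
  then show ?thesis using that d by blast
qed

text \<open>Any peak of \<open>d\<close> serves as \<open>(a, b)\<close>. Hence the vanishing sets
  of pairs are the minimal antipodal sets.\<close>

lemma antipodal_contains_vanishing:
  fixes d :: "('a \<times> 'a) \<Rightarrow>\<^sub>C real"
  assumes "d \<in> SPM"
  obtains a b where "a \<noteq> b" "vanishing {a, b} \<subseteq> antipodal d"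
proof -
  obtain a b where ab: "d (a, b) = 1" "a \<noteq> b" using SPM_peak[OF assms] .
  then have "vanishing {a, b} \<subseteq> antipodal d"
    using dist_eq_1_iff[OF assms] by (fastforce simp: antipodal_def vanishing_doubleton)
  then show ?thesis using that ab by blast
qed

text \<open>If \<open>B\<close> had a point \<open>c\<close> outside \<open>A\<close>, one could
  collapse \<open>A\<close> and the other point \<open>e\<close> of \<open>B\<close> while keeping
  \<open>c\<close> at distance 1.\<close>

lemma vanishing_subset_imp_eq:
  fixes A B :: "'a set"
  assumes "card A = 2" "card B = 2" "vanishing A \<subseteq> vanishing B"
  shows "A = B"
proof (rule ccontr)
  assume "A \<noteq> B"
  have fin: "finite A" "finite B" using assms(1-2) by (simp add: card_ge_0_finite)+
  then have "\<not> B \<subseteq> A" 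
    using card_subset_eq[OF fin(1), of B] \<open>A \<noteq> B\<close> assms(1,2) by auto
  then obtain c where c: "c \<in> B" "c \<notin> A" by blast
  then obtain e where e: "e \<in> B" "e \<noteq> c" using assms(2) by (auto simp: card_2_iff)
  have "insert e A \<inter> {c} = {}" using c e by blast
  then obtain \<sigma> where \<sigma>: "\<sigma> \<in> vanishing (insert e A)" "\<sigma> (e, c) = 1"
    using separating_pseudometric[of "insert e A" "{c}" e c] fin by blast
  then have "\<sigma> \<in> vanishing A" by (simp add: vanishing_def)
  then have "\<sigma> \<in> vanishing B" using assms(3) by blast
  then show False using c e \<sigma> by (simp add: vanishing_def)
qed

text \<open>Converse of \<open>vanishing_Int_subset_triangle\<close>: the conclusions make
  \<open>C\<close> the third side of a triangle with sides \<open>A\<close> and \<open>B\<close>. A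
  point of \<open>C\<close> outside both could be kept apart from all the others; disjoint
  \<open>A\<close> and \<open>B\<close> could be collapsed to two different points, with
  \<open>C\<close> meeting both.\<close>

lemma vanishing_Int_subset_imp_triangle:
  fixes A B C :: "'a set"
  assumes "card A = 2" "card B = 2" "card C = 2" "C \<noteq> A" "C \<noteq> B"
    and sub: "vanishing A \<inter> vanishing B \<subseteq> vanishing C"
  shows "C \<subseteq> A \<union> B" "A \<inter> B \<noteq> {}"
proof -
  have fin: "finite A" "finite B" "finite C" using assms(1-3) by (simp add: card_ge_0_finite)+
  show *: "C \<subseteq> A \<union> B"
  proof (rule ccontr)
    assume "\<not> C \<subseteq> A \<union> B"
    then obtain c where c: "c \<in> C" "c \<notin> A \<union> B" by blast
    then obtain e where e: "e \<in> C" "e \<noteq> c" using assms(3) by (auto simp: card_2_iff)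
    have "insert e (A \<union> B) \<inter> {c} = {}" using c e by blast
    then obtain \<sigma> where \<sigma>: "\<sigma> \<in> vanishing (insert e (A \<union> B))" "\<sigma> (e, c) = 1"
      using separating_pseudometric[of "insert e (A \<union> B)" "{c}" e c] fin by blast
    then have "\<sigma> \<in> vanishing A \<inter> vanishing B" by (simp add: vanishing_def)
    then have "\<sigma> \<in> vanishing C" using sub by blast
    then show False using c e \<sigma> by (simp add: vanishing_def)
  qed
  show "A \<inter> B \<noteq> {}"
  proof
    assume "A \<inter> B = {}"
    have "\<not> C \<subseteq> A" "\<not> C \<subseteq> B"
      using card_subset_eq[OF fin(1), of C] card_subset_eq[OF fin(2), of C] assms by auto
    then obtain x y where xy: "x \<in> C" "x \<in> A" "y \<in> C" "y \<in> B" using * by blast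
    obtain \<sigma> where \<sigma>: "\<sigma> \<in> vanishing A" "\<sigma> \<in> vanishing B" "\<sigma> (x, y) = 1"
      using separating_pseudometric[OF fin(1,2) \<open>A \<inter> B = {}\<close> xy(2,4)] by blast
    then have "\<sigma> \<in> vanishing C" using sub by blast
    then show False using \<sigma> xy by (simp add: vanishing_def)
  qed
qed

section \<open>Distance to a vanishing set\<close>

text \<open>Identifying \<open>a\<close> with \<open>b\<close> lowers \<open>d\<close> by at most
  \<open>d (a, b)\<close>, but may destroy the peak and thus the norm 1. So \<open>d\<close> is
  first raised by at most the same amount, and the quotient is then cut off at 1.\<close>

lemma dist_vanishing_le:
  fixes d :: "('a \<times> 'a) \<Rightarrow>\<^sub>C real"
  assumes d: "d \<in> SPM" and "a \<noteq> b" and c: "c \<noteq> a" "c \<noteq> b"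
  obtains \<rho> where "\<rho> \<in> vanishing {a, b}" "dist d \<rho> \<le> d (a, b)"
proof (cases "d (a, b) = 1")
  case True
  \<comment> \<open>Here any element vanishing at \<open>(a, b)\<close> will do; the third point
    \<open>c\<close> provides one.\<close>
  obtain \<rho> where \<rho>: "\<rho> \<in> vanishing {a, b}"
    using separating_pseudometric[of "{a, b}" "{c}" a c] c by auto
  then have "\<rho> \<in> SPM" by (simp add: vanishing_def)
  have "dist d \<rho> = 1"
    using \<rho> True unfolding dist_eq_1_iff[OF d \<open>\<rho> \<in> SPM\<close>] by (auto simp: vanishing_doubleton)
  then show ?thesis using that \<rho> True by simp
next
  case False
  define t where "t = d (a, b)"
  have t: "0 \<le> t" "t < 1" using False SPM_dest(1,5)[OF d, of a b] by (simp add: t_def)+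
  obtain p q where pq: "d (p, q) = 1" "p \<noteq> q" using SPM_peak[OF d] by blast
  \<comment> \<open>\<open>M\<close> is chosen so that \<open>min (M * m x y) t\<close> equals \<open>t\<close> on the four relevant pairs of points,
    except those that coincide (for them \<open>1 / 0 = 0\<close>).\<close>
  define M where "M = 1 / m p a + 1 / m p b + 1 / m a q + 1 / m b q"
  have Mge: "1 / m p a \<le> M" "1 / m p b \<le> M" "1 / m a q \<le> M" "1 / m b q \<le> M" "0 \<le> M"
    using nonneg by (simp add: M_def)+
  \<comment> \<open>The added term is a pseudometric with values between 0 and \<open>t\<close>,
    meant to offset the loss caused by identifying \<open>a\<close> with \<open>b\<close>.\<close>
  define D where "D x y = d (x, y) + min (M * m x y) t" for x y
  have D_far: "D x y = d (x, y) + t" if "x \<noteq> y" "1 / m x y \<le> M" for x y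
  proof -
    have "m x y > 0" using that nonneg[of x y] eq_0_iff[of x y] by simp
    then have "1 \<le> M * m x y" using that by (simp add: divide_simps)
    then show ?thesis using t by (simp add: D_def)
  qed
  have D0: "0 \<le> D x y" "D x x = 0" "D x y = D y x" for x y
    using SPM_dest(1-3)[OF d] nonneg[of x y] \<open>0 \<le> M\<close> t sym[of x y] eq_0_iff[of x x]
    by (simp add: D_def)+
  have D_tri: "D x z \<le> D x y + D y z" for x y z
  proof -
    have "M * m x z \<le> M * m x y + M * m y z"
      using mult_left_mono[OF triangle[of x z y] \<open>0 \<le> M\<close>] by (simp add: distrib_left)
    moreover have "0 \<le> M * m x y" "0 \<le> M * m y z" using nonneg \<open>0 \<le> M\<close> by simp+
    ultimately have "min (M * m x z) t \<le> min (M * m x y) t + min (M * m y z) t"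
      using t by (auto simp: min_def)
    then show ?thesis using SPM_dest(4)[OF d, of x z y] by (simp add: D_def)
  qed
  have D_ge: "d (x, y) \<le> D x y" and D_le: "D x y \<le> d (x, y) + t" for x y
    using nonneg[of x y] \<open>0 \<le> M\<close> t by (simp add: D_def)+
  define Q where "Q x y = min (D x y) (min (D x a + D b y) (D x b + D a y))" for x y
  have Q_tri: "Q x z \<le> Q x y + Q y z" for x y z
    unfolding Q_def by (rule quotient_pseudometric_triangle) (rule D0 D_tri)+
  have Q_sym: "Q x y = Q y x" for x y
    using D0(3) by (simp add: Q_def min.commute add.commute)
  have Q_ge: "d (x, y) - t \<le> Q x y" for x y
    using D_ge[of x y] D_ge[of x a] D_ge[of b y] D_ge[of x b] D_ge[of a y] t
      SPM_dest(4)[OF d, of x y a] SPM_dest(4)[OF d, of a y b] SPM_dest(4)[OF d, of x y b]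
      SPM_dest(4)[OF d, of b y a] SPM_dest(3)[OF d, of a b]
    by (auto simp: Q_def t_def)
  have Q0: "0 \<le> Q x y" "Q x x = 0" "Q a b = 0" for x y
    using D0(1,2) by (force simp: Q_def)+
  \<comment> \<open>Since \<open>d (a, b) < 1\<close>, the peak pair is not \<open>{a, b}\<close>;
    hence no shortcut from \<open>p\<close> to \<open>q\<close> has two trivial legs.\<close>
  have not_ab: "\<not> (p = a \<and> q = b)" "\<not> (p = b \<and> q = a)"
    using False pq SPM_dest(3)[OF d, of a b] by force+
  \<comment> \<open>A shortcut through the identified pair saves at most \<open>t\<close>, while at least one of its two
    legs is nontrivial and has been lengthened by \<open>t\<close>; so the peak of \<open>d\<close> survives the quotient.\<close>
  have shortcut: "1 \<le> D p u + D v q"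
    if uv: "{u, v} = {a, b}" for u v
  proof -
    have duv: "d (u, v) = t" using uv SPM_dest(3)[OF d, of a b] by (auto simp: t_def doubleton_eq_iff)
    have "\<not> (p = u \<and> v = q)" using uv not_ab by (auto simp: doubleton_eq_iff)
    moreover have "D p u = d (p, u) + t" if "p \<noteq> u"
      by (rule D_far[OF that]) (use uv Mge in \<open>auto simp: doubleton_eq_iff\<close>)
    moreover have "D v q = d (v, q) + t" if "v \<noteq> q"
      by (rule D_far[OF that]) (use uv Mge in \<open>auto simp: doubleton_eq_iff\<close>)
    moreover have "1 \<le> d (p, u) + (t + d (v, q))"
      using SPM_dest(4)[OF d, of p q u] SPM_dest(4)[OF d, of u q v] duv pq by simp
    ultimately show ?thesis
      using D_ge[of p u] D_ge[of v q] t by linarith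
  qed
  have Q_peak: "1 \<le> Q p q"
    using shortcut[of a b] shortcut[of b a] D_ge[of p q] pq by (auto simp: Q_def)
  \<comment> \<open>As \<open>d\<close> is at most 1, the cut-off at 1 keeps the bounds
    \<open>d - t\<close> and \<open>d + t\<close>.\<close>
  obtain \<rho> where "\<rho> \<in> SPM" and \<rho>: "\<And>x y. apply_bcontfun \<rho> (x, y) = min (Q x y) 1"
  proof (rule SPM_intro[of "\<lambda>x y. min (Q x y) 1" p q])
    show "continuous_on UNIV (\<lambda>p. min (Q (fst p) (snd p)) 1)"
      unfolding Q_def D_def
      by (intro continuous_intros cont_comp
        continuous_on_compose2[OF continuous_on_apply_bcontfun[of UNIV d]]; simp)
    show "min (Q p q) 1 = 1" using Q_peak by simp
    show "min (Q x z) 1 \<le> min (Q x y) 1 + min (Q y z) 1" for x y z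
      using Q_tri[of x z y] Q0(1)[of x y] Q0(1)[of y z] by auto
    show "min (Q x y) 1 = min (Q y x) 1" for x y using Q_sym by simp
  qed (use Q0 in simp)+
  have "\<rho> \<in> vanishing {a, b}" using \<rho> \<open>\<rho> \<in> SPM\<close> Q0 by (simp add: vanishing_doubleton)
  moreover have "dist d \<rho> \<le> t"
  proof (rule dist_bound)
    fix z show "dist (d z) (\<rho> z) \<le> t"
    proof (cases z)
      case (Pair x y)
      have "Q x y \<le> D x y" by (simp add: Q_def)
      then show ?thesis
        using Q_ge[of x y] D_le[of x y] SPM_dest(5)[OF d, of x y] t
        by (auto simp: Pair \<rho> dist_real_def)
    qed
  qed
  ultimately show ?thesis using that t_def by blast
qed

section \<open>Recovering pairs of points; spaces with two points\<close>

lemma eq_pair_if_SPM_eq: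
  fixes a b x y :: 'a
  assumes "\<And>d. d \<in> SPM \<Longrightarrow> d (a, b) = d (x, y)" "a \<noteq> b"
  shows "{a, b} = {x, y}"
proof (rule peaked_metric[OF assms(2)])
  fix d :: "('a \<times> 'a) \<Rightarrow>\<^sub>C real"
  assume "d \<in> SPM" and d: "\<And>x y. d (x, y) = 1 \<longleftrightarrow> {x, y} = {a, b}"
  then have "d (x, y) = 1" using assms(1)[of d] d[of a b] by simp
  then show ?thesis using d[of x y] by simp
qed

text \<open>Only one distance is free, and the norm fixes it to 1; so \<open>SPM\<close> has a
  single element.\<close>

lemma SPM_two_points_unique:
  fixes a b :: 'a and d :: "('a \<times> 'a) \<Rightarrow>\<^sub>C real"
  assumes "UNIV = {a, b}" "d \<in> SPM" "a \<noteq> b"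
  shows "d (x, y) = (if x = y then 0 else 1)"
proof -
  obtain p q where "d (p, q) = 1" "p \<noteq> q" using SPM_peak[OF assms(2)] .
  moreover have "x \<in> {a, b}" "y \<in> {a, b}" "p \<in> {a, b}" "q \<in> {a, b}" using assms by blast+
  ultimately show ?thesis using SPM_dest(2,3)[OF assms(2)] by fastforce
qed

text \<open>One element equals 1 at \<open>(a, b)\<close>, another vanishes there. Thus the size of
  \<open>SPM\<close> detects two-point spaces, and a surjection can carry this case over.\<close>

lemma SPM_not_singleton:
  fixes a b c :: 'a
  assumes "a \<noteq> b" "c \<noteq> a" "c \<noteq> b"
  shows "\<exists>d\<in>SPM. \<exists>\<rho>\<in>SPM. d \<noteq> (\<rho> :: ('a \<times> 'a) \<Rightarrow>\<^sub>C real)"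
proof -
  obtain d where "d \<in> SPM" "d (a, b) = 1"
    by (rule peaked_metric[OF assms(1)]) auto
  moreover obtain \<rho> where "\<rho> \<in> vanishing {a, b}"
    using separating_pseudometric[of "{a, b}" "{c}" a c] assms by auto
  ultimately have "\<rho> \<in> SPM" "d \<noteq> \<rho>" by (fastforce simp: vanishing_doubleton)+
  then show ?thesis using \<open>d \<in> SPM\<close> by blast
qed

end

section \<open>Bijections between two-point subsets\<close>

lemma card_2_elem:
  assumes "card A = 2" "p \<in> A"
  shows "\<exists>q. A = {p, q} \<and> p \<noteq> q"
proof -
  obtain u v where "A = {u, v}" "u \<noteq> v" using assms(1) by (auto simp: card_2_iff)
  then show ?thesis using assms(2) by (intro exI[of _ "if p = u then v else u"]) auto
qed

text \<open>Related to Whitney's theorem on line graphs, here for complete graphs: \<psi> x is the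
  common point of the images of all edges at \<open>x\<close>. On four points a bijection of edges
  may exchange triangles and stars; the assumption \<open>triangle\<close> excludes this.\<close>

lemma edge_bijection_induced:
  fixes \<tau> :: "'a set \<Rightarrow> 'b set"
  assumes \<tau>: "bij_betw \<tau> {A. card A = 2} {B. card B = 2}"
    and triangle: "\<And>x y z. \<lbrakk>x \<noteq> y; y \<noteq> z; x \<noteq> z\<rbrakk> \<Longrightarrow>
      \<tau> {y, z} \<subseteq> \<tau> {x, y} \<union> \<tau> {x, z} \<and> \<tau> {x, y} \<inter> \<tau> {x, z} \<noteq> {}"
    and three: "\<And>x y :: 'a. \<exists>z. z \<noteq> x \<and> z \<noteq> y"
  obtains \<psi> where "bij \<psi>" "\<And>x y. x \<noteq> y \<Longrightarrow> \<tau> {x, y} = {\<psi> x, \<psi> y}"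
proof -
  have card: "card (\<tau> {x, y}) = 2" if "x \<noteq> y" for x y
    using bij_betwE[OF \<tau>] that by simp
  have inj: "\<tau> {x, y} \<noteq> \<tau> {u, v}" if "x \<noteq> y" "u \<noteq> v" "{x, y} \<noteq> {u, v}" for x y u v
    using inj_onD[OF bij_betw_imp_inj_on[OF \<tau>], of "{x, y}" "{u, v}"] that by auto
  have tri: "\<exists>p q r. p \<noteq> q \<and> q \<noteq> r \<and> p \<noteq> r \<and>
      \<tau> {x, y} = {p, q} \<and> \<tau> {x, z} = {p, r} \<and> \<tau> {y, z} = {q, r}"
    if xyz: "x \<noteq> y" "y \<noteq> z" "x \<noteq> z" for x y z
  proof -
    obtain p where p: "p \<in> \<tau> {x, y}" "p \<in> \<tau> {x, z}" using triangle[OF xyz] by blast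
    obtain q where q: "\<tau> {x, y} = {p, q}" "p \<noteq> q"
      using card_2_elem[OF card[OF xyz(1)] p(1)] by blast
    obtain r where r: "\<tau> {x, z} = {p, r}" "p \<noteq> r"
      using card_2_elem[OF card[OF xyz(3)] p(2)] by blast
    obtain u v where uv: "\<tau> {y, z} = {u, v}" "u \<noteq> v"
      using card[OF xyz(2)] by (auto simp: card_2_iff)
    have ne: "{x, y} \<noteq> {x, z}" "{x, y} \<noteq> {y, z}" "{x, z} \<noteq> {y, z}"
      using xyz by (force simp: doubleton_eq_iff)+
    have ne': "{p, q} \<noteq> {p, r}" "{p, q} \<noteq> {u, v}" "{p, r} \<noteq> {u, v}"
      using inj[OF xyz(1,3) ne(1)] inj[OF xyz(1,2) ne(2)] inj[OF xyz(3,2) ne(3)] q r uv by simp+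
    have "{u, v} \<subseteq> {p, q, r}" using triangle[OF xyz] q(1) r(1) uv(1) by auto
    then have "{u, v} = {q, r}" using uv(2) ne' by auto
    moreover have "q \<noteq> r" using ne'(1) by blast
    ultimately show ?thesis using q r uv by auto
  qed
  have "\<exists>p. \<forall>y. y \<noteq> x \<longrightarrow> p \<in> \<tau> {x, y}" for x
  proof -
    obtain y where "y \<noteq> x" using three[of x x] by blast
    moreover obtain z where "z \<noteq> x" "z \<noteq> y" using three[of x y] by blast
    ultimately have yz: "x \<noteq> y" "y \<noteq> z" "x \<noteq> z" by blast+
    obtain p q r where pqr: "p \<noteq> q" "q \<noteq> r" "p \<noteq> r"
      "\<tau> {x, y} = {p, q}" "\<tau> {x, z} = {p, r}" "\<tau> {y, z} = {q, r}" using tri[OF yz] by blast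
    \<comment> \<open>An image edge that avoids \<open>p\<close> but meets \<open>{p, q}\<close> and
      \<open>{p, r}\<close> must be \<open>{q, r}\<close>, which is already the image of
      \<open>{y, z}\<close>.\<close>
    have "p \<in> \<tau> {x, w}" if "w \<noteq> x" for w
    proof (rule ccontr)
      assume p: "p \<notin> \<tau> {x, w}"
      then have w: "x \<noteq> w" "y \<noteq> w" "z \<noteq> w" using that pqr by blast+
      then have "\<tau> {x, y} \<inter> \<tau> {x, w} \<noteq> {}" "\<tau> {x, z} \<inter> \<tau> {x, w} \<noteq> {}"
        using triangle yz by blast+
      then have "{q, r} \<subseteq> \<tau> {x, w}" using p pqr by auto
      moreover have "card (\<tau> {x, w}) = 2" "finite (\<tau> {x, w})"
        using card[OF w(1)] by (simp add: card_ge_0_finite)+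
      ultimately have "\<tau> {x, w} = \<tau> {y, z}"
        using card_subset_eq[of "\<tau> {x, w}" "{q, r}"] pqr by simp
      then show False using inj[OF w(1) yz(2)] w yz by (auto simp: doubleton_eq_iff)
    qed
    then show ?thesis by blast
  qed
  then obtain \<psi> where "\<forall>x y. y \<noteq> x \<longrightarrow> \<psi> x \<in> \<tau> {x, y}"
    using choice[of "\<lambda>x p. \<forall>y. y \<noteq> x \<longrightarrow> p \<in> \<tau> {x, y}"] by blast
  then have \<psi>: "\<psi> x \<in> \<tau> {x, y}" if "y \<noteq> x" for x y using that by blast
  have \<psi>_inj: "\<psi> x \<noteq> \<psi> y" if "x \<noteq> y" for x y
  proof
    assume eq: "\<psi> x = \<psi> y"
    obtain z where z: "z \<noteq> x" "z \<noteq> y" using three by blast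
    \<comment> \<open>The three sides of the image triangle have no common point.\<close>
    have "\<psi> x \<in> \<tau> {x, y}" "\<psi> x \<in> \<tau> {x, z}" "\<psi> x \<in> \<tau> {y, z}"
      using \<psi>[of y x] \<psi>[of z x] \<psi>[of z y] eq z that by simp+
    then show False using tri[of x y z] that z by auto
  qed
  have \<psi>_eq: "\<tau> {x, y} = {\<psi> x, \<psi> y}" if "x \<noteq> y" for x y
  proof -
    have "{\<psi> x, \<psi> y} \<subseteq> \<tau> {x, y}"
      using \<psi>[of y x] \<psi>[of x y] that by (simp add: insert_commute)
    moreover have "finite (\<tau> {x, y})" using card[OF that] by (simp add: card_ge_0_finite)
    ultimately show ?thesis
      using card_subset_eq[of "\<tau> {x, y}" "{\<psi> x, \<psi> y}"] card[OF that] \<psi>_inj[OF that] by simp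
  qed
  have "p \<in> range \<psi>" for p
  proof -
    \<comment> \<open>\<open>undefined\<close> is just some point: two distinct values of \<psi>
      yield a point \<open>r\<close> other than \<open>p\<close>, and \<open>{p, r}\<close> is the
      image of an edge.\<close>
    obtain x :: 'a where "x \<noteq> undefined" using three[of undefined undefined] by blast
    then have "\<psi> x \<noteq> p \<or> \<psi> undefined \<noteq> p" using \<psi>_inj[of x undefined] by auto
    then obtain r where "r \<noteq> p" by blast
    then have "{p, r} \<in> \<tau> ` {A. card A = 2}" using bij_betw_imp_surj_on[OF \<tau>] by auto
    then obtain u v where "u \<noteq> v" "{p, r} = \<tau> {u, v}" by (auto simp: card_2_iff)
    then show ?thesis using \<psi>_eq[of u v] by auto
  qed
  then have "bij \<psi>" using \<psi>_inj by (auto simp: bij_def inj_def)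
  then show ?thesis using that \<psi>_eq by blast
qed

section \<open>Action of a surjective isometry on vanishing sets and values\<close>

locale SPM_isometry = X: compact_metric mX + Y: compact_metric mY
  for mX :: "'a::topological_space \<Rightarrow> 'a \<Rightarrow> real"
    and mY :: "'b::topological_space \<Rightarrow> 'b \<Rightarrow> real" +
  fixes T :: "(('a \<times> 'a) \<Rightarrow>\<^sub>C real) \<Rightarrow> (('b \<times> 'b) \<Rightarrow>\<^sub>C real)"
  assumes isometry: "surjective_isometry_on T SPM SPM"
begin

lemma T_image: "T ` SPM = SPM"
  and T_dist: "\<lbrakk>d \<in> SPM; \<rho> \<in> SPM\<rbrakk> \<Longrightarrow> dist (T d) (T \<rho>) = dist d \<rho>"
  using isometry by (simp add: surjective_isometry_on_def)+

lemma T_in_SPM: "d \<in> SPM \<Longrightarrow> T d \<in> SPM"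
  using T_image by blast

lemma T_inj: "inj_on T SPM"
proof (rule inj_onI)
  fix d \<rho> assume "d \<in> SPM" "\<rho> \<in> SPM" "T d = T \<rho>"
  then show "d = \<rho>" using T_dist[of d \<rho>] by simp
qed

lemma T_antipodal:
  assumes "d \<in> SPM"
  shows "T ` antipodal d = antipodal (T d)"
proof
  show "T ` antipodal d \<subseteq> antipodal (T d)"
    using assms T_dist T_in_SPM by (auto simp: antipodal_def)
  show "antipodal (T d) \<subseteq> T ` antipodal d"
  proof
    fix \<rho>' assume "\<rho>' \<in> antipodal (T d)"
    then have \<rho>': "\<rho>' \<in> SPM" "dist (T d) \<rho>' = 1" by (simp add: antipodal_def)+
    then obtain \<rho> where "\<rho> \<in> SPM" "\<rho>' = T \<rho>" using T_image by blast
    then show "\<rho>' \<in> T ` antipodal d" using \<rho>' T_dist[OF assms] by (auto simp: antipodal_def)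
  qed
qed

text \<open>Minimality: the image of \<open>vanishing A\<close> is antipodal and contains some
  \<open>vanishing {p, q}\<close>. The latter pulls back to an antipodal set inside
  \<open>vanishing A\<close>, which contains the vanishing set of a pair; this pair must be
  \<open>A\<close>, so equality holds throughout.\<close>

lemma vanishing_image:
  assumes "card A = 2"
  obtains B where "card B = 2" "T ` vanishing A = vanishing B"
proof -
  obtain a b where ab: "A = {a, b}" "a \<noteq> b" using assms by (auto simp: card_2_iff)
  obtain d where d: "d \<in> SPM" "antipodal d = vanishing A"
    using X.vanishing_is_antipodal[OF ab(2)] ab(1) by auto
  obtain p q where pq: "p \<noteq> q" "vanishing {p, q} \<subseteq> antipodal (T d)"
    using Y.antipodal_contains_vanishing[OF T_in_SPM[OF d(1)]] .
  obtain e where "e \<in> SPM" "antipodal e = vanishing {p, q}"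
    using Y.vanishing_is_antipodal[OF pq(1)] .
  moreover then obtain d' where "d' \<in> SPM" "e = T d'" using T_image by blast
  ultimately have d': "d' \<in> SPM" "antipodal (T d') = vanishing {p, q}" by simp+
  have "T ` antipodal d' \<subseteq> T ` antipodal d"
    using T_antipodal[OF d(1)] T_antipodal[OF d'(1)] d' pq by simp
  then have "antipodal d' \<subseteq> antipodal d"
    using inj_on_image_subset_iff[OF T_inj] by (simp add: antipodal_def)
  moreover obtain x y where xy: "x \<noteq> y" "vanishing {x, y} \<subseteq> antipodal d'"
    using X.antipodal_contains_vanishing[OF d'(1)] .
  ultimately have "{x, y} = A"
    using X.vanishing_subset_imp_eq[of "{x, y}" A] assms d(2) by auto
  then have "antipodal d' = vanishing A"
    using xy \<open>antipodal d' \<subseteq> antipodal d\<close> d(2) by auto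
  then have "T ` vanishing A = vanishing {p, q}" using T_antipodal[OF d'(1)] d'(2) by simp
  then show ?thesis using that[of "{p, q}"] pq(1) by simp
qed

text \<open>The preimage of \<open>vanishing B\<close> is antipodal and contains some
  \<open>vanishing {a, b}\<close>, whose image is a vanishing set inside \<open>vanishing B\<close>,
  hence equal to it.\<close>

lemma vanishing_preimage:
  assumes "card B = 2"
  obtains A where "card A = 2" "T ` vanishing A = vanishing B"
proof -
  obtain p q where pq: "B = {p, q}" "p \<noteq> q" using assms by (auto simp: card_2_iff)
  obtain e where "e \<in> SPM" "antipodal e = vanishing {p, q}"
    using Y.vanishing_is_antipodal[OF pq(2)] .
  moreover then obtain d where "d \<in> SPM" "e = T d" using T_image by blast
  ultimately have d: "d \<in> SPM" "antipodal (T d) = vanishing B" using pq(1) by simp+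
  obtain a b where ab: "a \<noteq> b" "vanishing {a, b} \<subseteq> antipodal d"
    using X.antipodal_contains_vanishing[OF d(1)] .
  obtain C where C: "card C = 2" "T ` vanishing {a, b} = vanishing C"
    using vanishing_image[of "{a, b}"] ab(1) by auto
  have "T ` vanishing {a, b} \<subseteq> T ` antipodal d" using ab(2) by (rule image_mono)
  then have "vanishing C \<subseteq> vanishing B" using T_antipodal[OF d(1)] d(2) C(2) by simp
  then have "C = B" using Y.vanishing_subset_imp_eq C(1) assms by blast
  then show ?thesis using that[of "{a, b}"] C ab(1) by simp
qed

lemma point_bijection:
  assumes three: "\<And>x y :: 'a. \<exists>z. z \<noteq> x \<and> z \<noteq> y"
  obtains \<psi> where "bij \<psi>" "\<And>x y. x \<noteq> y \<Longrightarrow> T ` vanishing {x, y} = vanishing {\<psi> x, \<psi> y}"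
proof -
  obtain \<tau> where \<tau>: "\<And>A. card A = 2 \<Longrightarrow> card (\<tau> A) = 2 \<and> T ` vanishing A = vanishing (\<tau> A)"
  proof
    fix A :: "'a set" assume "card A = 2"
    then have "\<exists>B :: 'b set. card B = 2 \<and> T ` vanishing A = vanishing B"
      by (rule vanishing_image) blast
    then show "card (SOME B :: 'b set. card B = 2 \<and> T ` vanishing A = vanishing B) = 2 \<and>
        T ` vanishing A = vanishing (SOME B. card B = 2 \<and> T ` vanishing A = vanishing B)"
      by (rule someI_ex)
  qed
  have inj: "A = B" if "card A = 2" "card B = 2" "\<tau> A = \<tau> B" for A B
  proof -
    have "T ` vanishing A = T ` vanishing B" using \<tau>[OF that(1)] \<tau>[OF that(2)] that(3) by simp
    then have "vanishing A = vanishing B"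
      by (simp add: inj_on_image_eq_iff[OF T_inj vanishing_subset_SPM vanishing_subset_SPM])
    then show ?thesis using X.vanishing_subset_imp_eq[OF that(1,2)] by simp
  qed
  have surj: "\<exists>A. card A = 2 \<and> \<tau> A = B" if B: "card B = 2" for B
  proof -
    obtain A where A: "card A = 2" "T ` vanishing A = vanishing B" using vanishing_preimage[OF B] .
    then have "\<tau> A = B" using Y.vanishing_subset_imp_eq[of "\<tau> A" B] \<tau>[OF A(1)] B by simp
    then show ?thesis using A by blast
  qed
  have "bij_betw \<tau> {A. card A = 2} {B. card B = 2}"
  proof (rule bij_betw_imageI)
    show "inj_on \<tau> {A. card A = 2}" using inj by (intro inj_onI) simp
    show "\<tau> ` {A. card A = 2} = {B. card B = 2}"
    proof (intro equalityI subsetI)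
      fix B assume "B \<in> {B :: 'b set. card B = 2}"
      then show "B \<in> \<tau> ` {A. card A = 2}" using surj[of B] by auto
    qed (use \<tau> in auto)
  qed
  moreover have "\<tau> {y, z} \<subseteq> \<tau> {x, y} \<union> \<tau> {x, z} \<and> \<tau> {x, y} \<inter> \<tau> {x, z} \<noteq> {}"
    if xyz: "x \<noteq> y" "y \<noteq> z" "x \<noteq> z" for x y z
  proof -
    have c: "card {x, y} = 2" "card {x, z} = 2" "card {y, z} = 2" using xyz by simp+
    \<comment> \<open>Being a triangle is an inclusion between vanishing sets, and the injective
      \<open>T\<close> respects intersections.\<close>
    have "T ` (vanishing {x, y} \<inter> vanishing {x, z}) \<subseteq> T ` vanishing {y, z}"
      by (intro image_mono vanishing_Int_subset_triangle)
    then have "vanishing (\<tau> {x, y}) \<inter> vanishing (\<tau> {x, z}) \<subseteq> vanishing (\<tau> {y, z})"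
      using inj_on_image_Int[OF T_inj vanishing_subset_SPM vanishing_subset_SPM, of "{x, y}" "{x, z}"]
        \<tau>[OF c(1)] \<tau>[OF c(2)] \<tau>[OF c(3)] by simp
    moreover have "\<tau> {y, z} \<noteq> \<tau> {x, y}" "\<tau> {y, z} \<noteq> \<tau> {x, z}"
      using inj[OF c(3,1)] inj[OF c(3,2)] xyz by (force simp: doubleton_eq_iff)+
    ultimately show ?thesis
      using Y.vanishing_Int_subset_imp_triangle[of "\<tau> {x, y}" "\<tau> {x, z}" "\<tau> {y, z}"] \<tau> c by simp
  qed
  ultimately obtain \<psi> where \<psi>: "bij \<psi>" "\<And>x y. x \<noteq> y \<Longrightarrow> \<tau> {x, y} = {\<psi> x, \<psi> y}"
    by (rule edge_bijection_induced[OF _ _ three]) (assumption | rule that)+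
  have "T ` vanishing {x, y} = vanishing {\<psi> x, \<psi> y}" if "x \<noteq> y" for x y
    using \<tau>[of "{x, y}"] \<psi>(2)[OF that] that by simp
  then show ?thesis using that \<psi>(1) by blast
qed

text \<open>Off the diagonal, both values are distances to corresponding vanishing sets. For each
  inequality, a nearest element is taken on one side and its counterpart is evaluated on the
  other.\<close>

lemma T_apply:
  assumes three: "\<And>x y :: 'a. \<exists>z. z \<noteq> x \<and> z \<noteq> y"
  obtains \<psi> where "bij \<psi>" "\<And>d x y. d \<in> SPM \<Longrightarrow> T d (\<psi> x, \<psi> y) = d (x, y)"
proof -
  obtain \<psi> where \<psi>: "bij \<psi>"
    "\<And>x y. x \<noteq> y \<Longrightarrow> T ` vanishing {x, y} = vanishing {\<psi> x, \<psi> y}"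
    by (rule point_bijection[OF three]) (rule that)
  have "T d (\<psi> x, \<psi> y) = d (x, y)" if d: "d \<in> SPM" for d x y
  proof (cases "x = y")
    case True
    then show ?thesis using SPM_dest(2)[OF d] SPM_dest(2)[OF T_in_SPM[OF d]] by simp
  next
    case False
    obtain z where z: "z \<noteq> x" "z \<noteq> y" using three by blast
    have inj: "\<psi> x \<noteq> \<psi> y" "\<psi> z \<noteq> \<psi> x" "\<psi> z \<noteq> \<psi> y"
      using \<psi>(1) False z by (simp add: bij_def inj_eq)+
    show ?thesis
    proof (rule antisym)
      obtain \<rho> where \<rho>: "\<rho> \<in> vanishing {x, y}" "dist d \<rho> \<le> d (x, y)"
        using X.dist_vanishing_le[OF d False z] .
      then have "\<rho> \<in> SPM" "T \<rho> \<in> vanishing {\<psi> x, \<psi> y}"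
        using \<psi>(2)[OF False] by (force simp: vanishing_doubleton)+
      then have "T d (\<psi> x, \<psi> y) \<le> dist (T d) (T \<rho>)"
        using dist_bounded[of "T d" "(\<psi> x, \<psi> y)" "T \<rho>"] by (simp add: vanishing_doubleton dist_real_def)
      then show "T d (\<psi> x, \<psi> y) \<le> d (x, y)" using \<rho> T_dist[OF d \<open>\<rho> \<in> SPM\<close>] by simp
    next
      obtain \<rho>' where \<rho>': "\<rho>' \<in> vanishing {\<psi> x, \<psi> y}" "dist (T d) \<rho>' \<le> T d (\<psi> x, \<psi> y)"
        using Y.dist_vanishing_le[OF T_in_SPM[OF d] inj] .
      then obtain \<rho> where \<rho>: "\<rho> \<in> vanishing {x, y}" "\<rho>' = T \<rho>"
        using \<psi>(2)[OF False] by blast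
      then have "\<rho> \<in> SPM" by (simp add: vanishing_def)
      have "d (x, y) \<le> dist d \<rho>"
        using dist_bounded[of d "(x, y)" \<rho>] \<rho> by (simp add: vanishing_doubleton dist_real_def)
      then show "d (x, y) \<le> T d (\<psi> x, \<psi> y)" using \<rho>' \<rho>(2) T_dist[OF d \<open>\<rho> \<in> SPM\<close>] by simp
    qed
  qed
  then show ?thesis using that \<psi>(1) by blast
qed

section \<open>Continuity and uniqueness of the point map\<close>

text \<open>For a metric \<open>d\<close> that dominates \<open>mX / 2\<close>, smallness of the
  continuous function \<open>T d (x, y)\<close> forces \<phi> y close to \<phi> x. A continuous
  bijection from a compact space to a Hausdorff space is a homeomorphism.\<close>

lemma induced_homeomorphism:
  fixes \<phi> :: "'b \<Rightarrow> 'a" and a b :: 'a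
  assumes "bij \<phi>" and T: "\<And>d x y. d \<in> SPM \<Longrightarrow> T d (x, y) = d (\<phi> x, \<phi> y)"
    and "a \<noteq> b"
  shows "homeomorphic_map euclidean euclidean \<phi>"
proof (rule continuous_imp_homeomorphic_map)
  obtain d where d: "d \<in> SPM" "\<And>x y. mX x y / 2 \<le> apply_bcontfun d (x, y)"
    by (rule X.peaked_metric[OF \<open>a \<noteq> b\<close>]) (rule that)
  have "\<exists>V. open V \<and> x \<in> V \<and> V \<subseteq> \<phi> -` U" if U: "open U" "\<phi> x \<in> U" for U x
  proof -
    obtain \<epsilon> where \<epsilon>: "\<epsilon> > 0" "\<And>z. mX (\<phi> x) z < \<epsilon> \<Longrightarrow> z \<in> U" using X.ball[OF U] by blast
    have "continuous_on UNIV (\<lambda>y. T d (x, y))"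
      by (rule continuous_on_compose2[OF continuous_on_apply_bcontfun[of UNIV]])
        (auto intro!: continuous_intros)
    then have "open {y. T d (x, y) < \<epsilon> / 2}"
      by (intro open_Collect_less continuous_intros)
    moreover have "x \<in> {y. T d (x, y) < \<epsilon> / 2}"
      using SPM_dest(2)[OF T_in_SPM[OF d(1)]] \<epsilon>(1) by simp
    moreover have "\<phi> y \<in> U" if "T d (x, y) < \<epsilon> / 2" for y
      using that T[OF d(1), of x y] d(2)[of "\<phi> x" "\<phi> y"] by (intro \<epsilon>(2)) simp
    ultimately show ?thesis by blast
  qed
  then have "open (\<phi> -` U)" if "open U" for U
    using that by (subst open_subopen) auto
  then show "continuous_map euclidean euclidean \<phi>"
    by (simp add: continuous_on_open_vimage)
  show "compact_space (euclidean :: 'b topology)" using Y.compact by (simp add: compact_space_def)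
  show "Hausdorff_space (euclidean :: 'a topology)"
    unfolding Hausdorff_space_def
  proof (intro allI impI, elim conjE)
    fix x y :: 'a assume "x \<noteq> y"
    define U where "U u v = {z. mX u z < mX v z}" for u v
    have "open (U x y)" "open (U y x)"
      unfolding U_def by (intro open_Collect_less X.cont_comp continuous_intros)+
    moreover have "x \<in> U x y" "y \<in> U y x"
      using \<open>x \<noteq> y\<close> X.nonneg[of x y] X.nonneg[of y x] X.eq_0_iff[of x y] X.eq_0_iff[of y x]
        X.eq_0_iff[of x x] X.eq_0_iff[of y y] by (auto simp: U_def)
    moreover have "disjnt (U x y) (U y x)" by (auto simp: U_def disjnt_def)
    ultimately show "\<exists>U V. openin euclidean U \<and> openin euclidean V \<and> x \<in> U \<and> y \<in> V \<and> disjnt U V"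
      by auto
  qed
qed (use \<open>bij \<phi>\<close> in \<open>simp add: bij_def\<close>)+

text \<open>\<open>T\<close> determines the pair of images of any two distinct points; \<phi> x is
  the common element of two such pairs, for two different partners \<open>y\<close> and
  \<open>z\<close> of \<open>x\<close>.\<close>

lemma point_map_unique:
  fixes \<phi> \<phi>' :: "'b \<Rightarrow> 'a"
  assumes "inj \<phi>" and three: "\<And>x y :: 'b. \<exists>z. z \<noteq> x \<and> z \<noteq> y"
    and T: "\<And>d x y. d \<in> SPM \<Longrightarrow> T d (x, y) = d (\<phi> x, \<phi> y)"
      "\<And>d x y. d \<in> SPM \<Longrightarrow> T d (x, y) = d (\<phi>' x, \<phi>' y)"
  shows "\<phi> = \<phi>'"
proof
  fix x
  have pair: "{\<phi> x, \<phi> y} = {\<phi>' x, \<phi>' y}" if "x \<noteq> y" for y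
    using that T \<open>inj \<phi>\<close> by (intro X.eq_pair_if_SPM_eq; simp add: inj_eq)
  obtain y where "y \<noteq> x" using three[of x x] by blast
  moreover obtain z where "z \<noteq> x" "z \<noteq> y" using three[of x y] by blast
  ultimately have "x \<noteq> y" "x \<noteq> z" "\<phi> y \<noteq> \<phi> z" using \<open>inj \<phi>\<close> by (force simp: inj_eq)+
  then show "\<phi> x = \<phi>' x"
    using pair[of y] pair[of z] by (auto simp: doubleton_eq_iff)
qed

end

section \<open>Existence and uniqueness, with the two-point case\<close>

lemma two_points_or_three:
  assumes "\<exists>x y :: 'a. x \<noteq> y"
  obtains "card (UNIV :: 'a set) = 2" | "\<And>x y :: 'a. \<exists>z. z \<noteq> x \<and> z \<noteq> y"
proof (cases "\<exists>x y :: 'a. \<forall>z. z = x \<or> z = y")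
  case True
  then obtain a b :: 'a where ab: "UNIV = {a, b}" by blast
  obtain x y :: 'a where "x \<noteq> y" using assms by blast
  moreover have "x \<in> {a, b}" "y \<in> {a, b}" unfolding ab[symmetric] by simp+
  ultimately have "a \<noteq> b" by auto
  then have "card (UNIV :: 'a set) = 2" unfolding ab by simp
  then show ?thesis using that by blast
qed (use that in blast)

theorem theorem1:
  fixes T :: "(('a::topological_space \<times> 'a) \<Rightarrow>\<^sub>C real) \<Rightarrow> (('b::topological_space \<times> 'b) \<Rightarrow>\<^sub>C real)"
  assumes "compact_space (euclidean :: 'a topology)" "metrizable_space (euclidean :: 'a topology)"
    and "\<exists>x y :: 'a. x \<noteq> y"
    and "compact_space (euclidean :: 'b topology)" "metrizable_space (euclidean :: 'b topology)"
    and "\<exists>x y :: 'b. x \<noteq> y"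
    and "surjective_isometry_on T SPM SPM"
  shows "(\<exists>\<phi> :: 'b \<Rightarrow> 'a. homeomorphic_map euclidean euclidean \<phi> \<and>
            (\<forall>d\<in>SPM. \<forall>x y. apply_bcontfun (T d) (x, y) = apply_bcontfun d (\<phi> x, \<phi> y))) \<and>
         (\<not> (card (UNIV :: 'a set) = 2 \<or> card (UNIV :: 'b set) = 2) \<longrightarrow>
           (\<exists>!\<phi> :: 'b \<Rightarrow> 'a. homeomorphic_map euclidean euclidean \<phi> \<and>
            (\<forall>d\<in>SPM. \<forall>x y. apply_bcontfun (T d) (x, y) = apply_bcontfun d (\<phi> x, \<phi> y))))"
proof -
  obtain mX :: "'a \<Rightarrow> 'a \<Rightarrow> real" where "compact_metric mX"
    using compact_metric_exists[OF assms(1,2)] .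
  moreover obtain mY :: "'b \<Rightarrow> 'b \<Rightarrow> real" where "compact_metric mY"
    using compact_metric_exists[OF assms(4,5)] .
  ultimately interpret SPM_isometry mX mY T
    using assms(7) by (simp add: SPM_isometry_def SPM_isometry_axioms_def)
  let ?P = "\<lambda>\<phi> :: 'b \<Rightarrow> 'a. \<forall>d\<in>SPM. \<forall>x y. T d (x, y) = d (\<phi> x, \<phi> y)"
  have "\<exists>\<phi>. bij \<phi> \<and> ?P \<phi>"
    using assms(3)
  proof (cases rule: two_points_or_three)
    case 1
    then obtain a b :: 'a where ab: "UNIV = {a, b}" "a \<noteq> b" by (auto simp: card_2_iff)
    have X_eq: "d = \<rho>" if "d \<in> SPM" "\<rho> \<in> SPM" for d \<rho> :: "('a \<times> 'a) \<Rightarrow>\<^sub>C real"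
      using X.SPM_two_points_unique[OF ab(1) that(1) ab(2)]
        X.SPM_two_points_unique[OF ab(1) that(2) ab(2)] by (intro bcontfun_eqI) auto
    \<comment> \<open>By surjectivity the target \<open>SPM\<close> is a singleton too, which leaves
      room for only two points.\<close>
    have Y_eq: "d = \<rho>" if "d \<in> SPM" "\<rho> \<in> SPM" for d \<rho> :: "('b \<times> 'b) \<Rightarrow>\<^sub>C real"
    proof -
      obtain d' \<rho>' where "d' \<in> SPM" "d = T d'" "\<rho>' \<in> SPM" "\<rho> = T \<rho>'"
        using \<open>d \<in> SPM\<close> \<open>\<rho> \<in> SPM\<close> unfolding T_image[symmetric] by blast
      then show ?thesis using X_eq[of d' \<rho>'] by simp
    qed
    have "card (UNIV :: 'b set) = 2"
      using assms(6)
    proof (cases rule: two_points_or_three)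
      case 2
      obtain p q :: 'b where "p \<noteq> q" using assms(6) by blast
      moreover obtain r where "r \<noteq> p" "r \<noteq> q" using 2 by blast
      ultimately show ?thesis using Y.SPM_not_singleton[of p q r] Y_eq by blast
    qed
    then obtain p q :: 'b where pq: "UNIV = {p, q}" "p \<noteq> q" by (auto simp: card_2_iff)
    \<comment> \<open>Either of the two bijections works, as distinct points always have distance
      1.\<close>
    define \<phi> where "\<phi> x = (if x = p then a else b)" for x
    have pq_cases: "x = p \<or> x = q" for x using pq(1) by blast
    have "inj \<phi>"
    proof (rule injI)
      fix x y assume "\<phi> x = \<phi> y"
      then show "x = y"
        using pq_cases[of x] pq_cases[of y] ab(2) by (auto simp: \<phi>_def split: if_splits)
    qed
    moreover have "range \<phi> = UNIV" using pq(2) by (auto simp: \<phi>_def ab(1) pq(1))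
    moreover have "T d (x, y) = d (\<phi> x, \<phi> y)" if "d \<in> SPM" for d x y
      using X.SPM_two_points_unique[OF ab(1) that ab(2)] \<open>inj \<phi>\<close>
        Y.SPM_two_points_unique[OF pq(1) T_in_SPM[OF that] pq(2)] by (simp add: inj_eq)
    ultimately show ?thesis by (auto simp: bij_def)
  next
    case 2
    then obtain \<psi> where \<psi>: "bij \<psi>" "\<And>d x y. d \<in> SPM \<Longrightarrow> T d (\<psi> x, \<psi> y) = d (x, y)"
      by (rule T_apply) (rule that)
    have "\<psi> (inv \<psi> x) = x" for x using \<psi>(1) by (simp add: bij_is_surj surj_f_inv_f)
    then have "T d (x, y) = d (inv \<psi> x, inv \<psi> y)" if "d \<in> SPM" for d x y
      using \<psi>(2)[OF that, of "inv \<psi> x" "inv \<psi> y"] by simp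
    then show ?thesis using bij_imp_bij_inv[OF \<psi>(1)] by blast
  qed
  then obtain \<phi> where \<phi>: "bij \<phi>" "?P \<phi>" by blast
  obtain a b :: 'a where "a \<noteq> b" using assms(3) by blast
  have homeo: "homeomorphic_map euclidean euclidean \<phi>"
    by (rule induced_homeomorphism[OF \<phi>(1) _ \<open>a \<noteq> b\<close>]) (use \<phi>(2) in blast)
  \<comment> \<open>Infinite types have \<open>card\<close> 0, so they fall under this case.\<close>
  have "\<phi>' = \<phi>" if "card (UNIV :: 'b set) \<noteq> 2" "?P \<phi>'" for \<phi>'
    using assms(6)
  proof (cases rule: two_points_or_three)
    case 2
    show ?thesis
      using point_map_unique[OF bij_is_inj[OF \<phi>(1)] 2, of \<phi>'] \<phi>(2) that(2) by simp
  qed (use that in simp)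
  then show ?thesis using homeo \<phi>(2) by blast
qed

end
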